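(* Let $G=(V,E,\omega)$ be a finite directed non-negatively weighted graph, $r\in V$ and $k>0$ an integer, and let $S=\{S_{rv}\}_{v\in V}$ be a solution to the Single-Source Top-$k$ Simple Shortest Paths problem for $G,r,k$. Let $v,w\in V$ and let $P_{rw}=P_{rv}\oplus P_{vw}$ be any path from $r$ to $w$ (with $P_{rv}$ a path from $r$ to $v$ and $P_{vw}$ a path from $v$ to $w$) such that $P_{rw}\in S'_{rw}$ for every $S'_{rw}\in\Gamma_{rw}$, and $P_{rv}\notin S_{rv}$. Then there exists a vertex $t\in V(S_{rv})\cap V(P_{vw})$.
   Context: $G=(V,E,\omega)$ is a finite directed graph, $E\subseteq V\times V$, with non-negative real edge weights $\omega$. A path from $s$ to $t$ is a vertex sequence $P=(s=v_1,\dots,v_\eta=t)$, $\eta\ge 1$, with $(v_i,v_{i+1})\in E$ for all $i<\eta$; $V(P)$ is its vertex set; it is simple if it has no repeated vertex; its weight is $\omega(P)=\sum_{i=1}^{\eta-1}\omega(v_i,v_{i+1})$. If $P'$ ends at the first vertex of $P''$, then $P'\oplus P''$ denotes their concatenation. A collection of top-$k$ simple shortest paths from $r$ to $v$ is a set of pairwise distinct simple paths from $r$ to $v$ that contains all simple $r$–$v$ paths if there are fewer than $k$ of them, and otherwise contains exactly $k$ simple $r$–$v$ paths such that every simple $r$–$v$ path not in the set has weight at least that of every path in the set. $\Gamma_{rv}$ is the family of all such collections ($\Gamma_{rr}=\{\{(r)\}\}$). A solution to the Single-Source Top-$k$ Simple Shortest Paths problem is a family $S=\{S_{rv}\}_{v\in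 V}$ with $S_{rv}\in\Gamma_{rv}$ for every $v\in V$. $V(S_{rv})$ denotes the set of predecessors of $v$ in $S$: the vertices $u\neq v$ that lie on some path of $S_{rv}$ (so $v\notin V(S_{rv})$). *)

theory Defs
  imports Complex_Main "Graph_Theory.Pair_Digraph" "Graph_Theory.Vertex_Walk"
begin

text \<open>
  Graphs are finite digraphs without parallel arcs (loops allowed), \<^locale>\<open>pair_fin_digraph\<close>.
  A path is a \<^const>\<open>vwalk\<close>, which may repeat vertices; a simple path is a \<^const>\<open>vpath\<close>.
\<close>

definition paths :: "'a pair_pre_digraph \<Rightarrow> 'a \<Rightarrow> 'a \<Rightarrow> 'a vwalk set" where
  "paths G s t = {p. vwalk p (with_proj G) \<and> hd p = s \<and> last p = t}"

definition simple_paths :: "'a pair_pre_digraph \<Rightarrow> 'a \<Rightarrow> 'a \<Rightarrow> 'a vwalk set" where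
  "simple_paths G s t = {p \<in> paths G s t. vpath p (with_proj G)}"

definition path_weight :: "('a \<times> 'a \<Rightarrow> real) \<Rightarrow> 'a vwalk \<Rightarrow> real" where
  "path_weight \<omega> p = sum_list (map \<omega> (vwalk_arcs p))"

text \<open>
  The collections of top-\<open>k\<close> simple shortest paths from \<open>r\<close> to \<open>v\<close>. In a finite graph there are
  only finitely many simple paths, so \<^const>\<open>card\<close> counts them faithfully.
\<close>

definition top_k_collections ::
  "'a pair_pre_digraph \<Rightarrow> ('a \<times> 'a \<Rightarrow> real) \<Rightarrow> nat \<Rightarrow> 'a \<Rightarrow> 'a \<Rightarrow> 'a vwalk set set" where
  "top_k_collections G \<omega> k r v =
    {C. C \<subseteq> simple_paths G r v \<and>
        (if card (simple_paths G r v) < k then simple_paths G r v \<subseteq> C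
         else card C = k \<and>
           (\<forall>Q \<in> simple_paths G r v - C. \<forall>P \<in> C. path_weight \<omega> P \<le> path_weight \<omega> Q))}"

definition top_k_solution ::
  "'a pair_pre_digraph \<Rightarrow> ('a \<times> 'a \<Rightarrow> real) \<Rightarrow> nat \<Rightarrow> 'a \<Rightarrow> ('a \<Rightarrow> 'a vwalk set) \<Rightarrow> bool" where
  "top_k_solution G \<omega> k r S \<longleftrightarrow> (\<forall>v \<in> pverts G. S v \<in> top_k_collections G \<omega> k r v)"

definition predecessors :: "('a \<Rightarrow> 'a vwalk set) \<Rightarrow> 'a \<Rightarrow> 'a set" where
  "predecessors S v = {u. u \<noteq> v \<and> (\<exists>P \<in> S v. u \<in> set P)}"

text \<open>The convention for paths from the root to itself needs no separate clause.\<close>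

lemma simple_paths_self:
  assumes "r \<in> pverts G"
  shows "simple_paths G r r = {[r]}"
proof -
  have "p = [r]" if "p \<noteq> []" "distinct p" "hd p = r" "last p = r" for p
    using that by (cases p) (auto split: if_splits)
  then show ?thesis
    using assms by (auto simp: simple_paths_def paths_def vpath_def vwalk_def)
qed

lemma top_k_collections_self:
  assumes "r \<in> pverts G" "k > 0"
  shows "top_k_collections G \<omega> k r r = {{[r]}}"
  using assms by (auto simp: top_k_collections_def simple_paths_self subset_singleton_iff)

end

theory Submission
  imports Defs
begin

text \<open>
  If no path of \<open>S v\<close> met \<open>P\<^sub>v\<^sub>w\<close> outside \<open>v\<close>, then each of them could replace the prefix \<open>P\<^sub>r\<^sub>v\<close>
  of \<open>P\<^sub>r\<^sub>w\<close>. Since \<open>P\<^sub>r\<^sub>v \<notin> S v\<close>, this produces \<open>k\<close> simple paths from \<open>r\<close> to \<open>w\<close> other than \<open>P\<^sub>r\<^sub>w\<close>,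
  none heavier than it, and then some top-\<open>k\<close> collection for \<open>w\<close> avoids \<open>P\<^sub>r\<^sub>w\<close>.
\<close>

text \<open>Greedy choice by induction on \<open>k\<close>: an element \<open>a\<close> with least
  \<open>f\<close>-value among those not yet chosen is added to \<open>C\<close>.\<close>

lemma ex_smallest_subset:
  fixes f :: "'b \<Rightarrow> 'c::linorder"
  assumes "finite A" "k \<le> card A"
  shows "\<exists>C \<subseteq> A. card C = k \<and> (\<forall>Q \<in> A - C. \<forall>P \<in> C. f P \<le> f Q)"
  using assms(2)
proof (induction k)
  case 0
  show ?case by (intro exI[of _ "{}"]) simp
next
  case (Suc k)
  then obtain C where C: "C \<subseteq> A" "card C = k" "\<forall>Q \<in> A - C. \<forall>P \<in> C. f P \<le> f Q"
    by auto
  have fin: "finite C" "finite (A - C)"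
    using C(1) assms(1) by (auto intro: finite_subset)
  have "A - C \<noteq> {}"
    using C Suc.prems by auto
  then obtain a where a: "a \<in> A - C" "\<forall>x \<in> A - C. f a \<le> f x"
    using ex_min_if_finite[of "f ` (A - C)"] fin(2) by (auto simp: not_less)
  then show ?case
    using C fin(1) by (intro exI[of _ "insert a C"]) auto
qed

text \<open>A choice of \<open>k\<close> smallest elements of \<open>A - {p}\<close> serves for
  \<open>A\<close> as well, once none of them is larger than \<open>p\<close>; the set
  \<open>B\<close> guarantees this.\<close>

lemma ex_smallest_subset_avoiding:
  fixes f :: "'b \<Rightarrow> 'c::linorder"
  assumes "finite A" "B \<subseteq> A - {p}" "card B = k" "\<forall>x \<in> B. f x \<le> f p"
  shows "\<exists>C \<subseteq> A - {p}. card C = k \<and> (\<forall>Q \<in> A - C. \<forall>P \<in> C. f P \<le> f Q)"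
proof -
  have "k \<le> card (A - {p})"
    using assms by (metis card_mono finite_Diff)
  then obtain C where C: "C \<subseteq> A - {p}" "card C = k"
      "\<forall>Q \<in> A - {p} - C. \<forall>P \<in> C. f P \<le> f Q"
    using ex_smallest_subset[of "A - {p}" k f] assms(1) by auto
  have "f c \<le> f p" if "c \<in> C" for c
  proof (rule ccontr)
    assume less: "\<not> f c \<le> f p"
    \<comment> \<open>If \<open>c\<close> exceeds \<open>p\<close>, it exceeds every element of
      \<open>B\<close>, so minimality of \<open>C\<close> leaves no element of \<open>B\<close>
      outside \<open>C\<close>. Equal sizes give \<open>B = C\<close>, which puts \<open>c\<close>
      itself under the bound \<open>f p\<close>.\<close>
    have "B \<subseteq> C"
    proof
      fix b assume "b \<in> B"
      then have "b \<in> A - {p}" "\<not> f c \<le> f b"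
        using assms(2,4) less by (auto dest: order_trans)
      then show "b \<in> C"
        using C(3) that by blast
    qed
    moreover have "finite C"
      using C(1) assms(1) by (auto intro: finite_subset)
    ultimately have "B = C"
      using C(2) assms(3) by (simp add: card_subset_eq)
    then show False
      using that less assms(4) by auto
  qed
  then show ?thesis
    using C by blast
qed

lemma finite_simple_paths:
  assumes "pair_fin_digraph G"
  shows "finite (simple_paths G s t)"
proof -
  interpret pair_fin_digraph G by fact
  show ?thesis
    by (rule finite_subset[OF _ vpaths_finite]) (auto simp: simple_paths_def)
qed

lemma paths_joinable:
  "P \<in> paths G u v \<Longrightarrow> Q \<in> paths G v w \<Longrightarrow> joinable P Q"
  by (auto simp: paths_def)

lemma join_in_paths:
  assumes "P \<in> paths G u v" "Q \<in> paths G v w"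
  shows "P \<oplus> Q \<in> paths G u w"
  using assms paths_joinable[OF assms]
  by (simp add: paths_def vwalk_joinI_vwalk vwalk_join_hd vwalk_join_last)

lemma path_weight_join:
  "joinable P Q \<Longrightarrow> path_weight \<omega> (P \<oplus> Q) = path_weight \<omega> P + path_weight \<omega> Q"
  by (simp add: path_weight_def vwalk_join_arcs)

lemma simple_paths_iff:
  "P \<in> simple_paths G s t \<longleftrightarrow> P \<in> paths G s t \<and> distinct P"
  by (auto simp: simple_paths_def paths_def)

text \<open>The missing simple path \<open>P\<close> rules out the case of fewer than
  \<open>k\<close> simple paths, since there \<open>C\<close> would contain them all.\<close>

lemma top_k_heavier:
  assumes "C \<in> top_k_collections G \<omega> k r v" "P \<in> simple_paths G r v" "P \<notin> C"
  shows "C \<subseteq> simple_paths G r v" "card C = k" "\<forall>Q \<in> C. path_weight \<omega> Q \<le> path_weight \<omega> P"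
  using assms by (auto simp: top_k_collections_def split: if_splits)

text \<open>Joining appends \<open>tl Q\<close> to \<open>P\<close>. Vertices of \<open>P\<close>
  other than \<open>v\<close> are predecessors and so avoid \<open>Q\<close>, while \<open>v\<close>
  occurs in \<open>Q\<close> only as its head.\<close>

lemma join_predecessors_disjoint:
  assumes "P \<in> S v" "P \<in> simple_paths G r v" "Q \<in> simple_paths G v w"
    and "predecessors S v \<inter> set Q = {}"
  shows "P \<oplus> Q \<in> simple_paths G r w"
proof -
  have Q: "Q = v # tl Q"
    using assms(3) by (cases Q) (auto simp: simple_paths_iff paths_def)
  then have "v \<notin> set (tl Q)" "distinct (tl Q)" "set (tl Q) \<subseteq> set Q"
    using assms(3) by (metis simple_paths_iff distinct.simps(2) set_subset_Cons)+
  then have "distinct (P \<oplus> Q)"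
    using assms by (auto simp: vwalk_join_def simple_paths_iff predecessors_def)
  then show ?thesis
    using assms(2,3) by (auto simp: simple_paths_iff join_in_paths)
qed

theorem lemma4:
  fixes G :: "'a pair_pre_digraph" and \<omega> :: "'a \<times> 'a \<Rightarrow> real"
    and k :: nat and r v w :: 'a
    and S :: "'a \<Rightarrow> 'a vwalk set" and P\<^sub>r\<^sub>w P\<^sub>r\<^sub>v P\<^sub>v\<^sub>w :: "'a vwalk"
  assumes "pair_fin_digraph G"
    and "\<And>e. e \<in> parcs G \<Longrightarrow> \<omega> e \<ge> 0"
    and "r \<in> pverts G" and "k > 0"
    and "top_k_solution G \<omega> k r S"
    and "v \<in> pverts G" and "w \<in> pverts G"
    and "P\<^sub>r\<^sub>v \<in> paths G r v" and "P\<^sub>v\<^sub>w \<in> paths G v w"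
    and "P\<^sub>r\<^sub>w = P\<^sub>r\<^sub>v \<oplus> P\<^sub>v\<^sub>w"
    and "\<And>S'\<^sub>r\<^sub>w. S'\<^sub>r\<^sub>w \<in> top_k_collections G \<omega> k r w \<Longrightarrow> P\<^sub>r\<^sub>w \<in> S'\<^sub>r\<^sub>w"
    and "P\<^sub>r\<^sub>v \<notin> S v"
  shows "\<exists>t. t \<in> predecessors S v \<inter> set P\<^sub>v\<^sub>w"
proof (rule ccontr)
  assume "\<not> ?thesis"
  then have disj: "predecessors S v \<inter> set P\<^sub>v\<^sub>w = {}"
    by blast
  have Sv: "S v \<in> top_k_collections G \<omega> k r v" and Sw: "S w \<in> top_k_collections G \<omega> k r w"
    using assms(5-7) by (auto simp: top_k_solution_def)
  \<comment> \<open>Simplicity of the given path is not assumed: it follows from membership in the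
    particular collection \<open>S w\<close>.\<close>
  have rw: "P\<^sub>r\<^sub>w \<in> simple_paths G r w"
    using Sw assms(11) by (auto simp: top_k_collections_def)
  have join: "joinable P\<^sub>r\<^sub>v P\<^sub>v\<^sub>w"
    using assms(8,9) by (rule paths_joinable)
  have "distinct P\<^sub>r\<^sub>v"
    using rw assms(10) by (simp add: simple_paths_iff vwalk_join_def)
  then have rv: "P\<^sub>r\<^sub>v \<in> simple_paths G r v"
    using assms(8) by (simp add: simple_paths_iff)
  \<comment> \<open>Overlapping at \<open>v\<close>, the join is also \<open>butlast\<close> of the
    first path followed by all of the second, so the second is a suffix of a distinct list.\<close>
  have "distinct P\<^sub>v\<^sub>w"
    using rw assms(10) join by (simp add: simple_paths_iff vwalk_join_def2)
  then have vw: "P\<^sub>v\<^sub>w \<in> simple_paths G v w"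
    using assms(9) by (simp add: simple_paths_iff)
  note Sv_top = top_k_heavier[OF Sv rv assms(12)]
  define B where "B = (\<lambda>P. P \<oplus> P\<^sub>v\<^sub>w) ` S v"
  have inj: "inj (\<lambda>P. P \<oplus> P\<^sub>v\<^sub>w)"
    by (simp add: inj_def vwalk_join_def)
  have "card B = k"
    unfolding B_def using Sv_top(2) inj by (metis card_image inj_on_subset subset_UNIV)
  moreover have "B \<subseteq> simple_paths G r w - {P\<^sub>r\<^sub>w}"
  proof
    fix R assume "R \<in> B"
    then obtain P where P: "P \<in> S v" "R = P \<oplus> P\<^sub>v\<^sub>w"
      by (auto simp: B_def)
    \<comment> \<open>Cancelling the common suffix from an equality would put the excluded prefix
      into \<open>S v\<close>.\<close>
    then have "R \<noteq> P\<^sub>r\<^sub>w"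
      using assms(10,12) by (auto simp: vwalk_join_def)
    then show "R \<in> simple_paths G r w - {P\<^sub>r\<^sub>w}"
      using P Sv_top(1) join_predecessors_disjoint[OF _ _ vw disj] by blast
  qed
  moreover have "\<forall>R \<in> B. path_weight \<omega> R \<le> path_weight \<omega> P\<^sub>r\<^sub>w"
  proof
    fix R assume "R \<in> B"
    then obtain P where P: "P \<in> S v" "R = P \<oplus> P\<^sub>v\<^sub>w"
      by (auto simp: B_def)
    then have "P \<in> paths G r v"
      using Sv_top(1) by (auto simp: simple_paths_iff)
    then have "joinable P P\<^sub>v\<^sub>w"
      using assms(9) by (rule paths_joinable)
    then show "path_weight \<omega> R \<le> path_weight \<omega> P\<^sub>r\<^sub>w"
      using P Sv_top(3) join assms(10) by (simp add: path_weight_join)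
  qed
  ultimately obtain C where C: "C \<subseteq> simple_paths G r w - {P\<^sub>r\<^sub>w}" "card C = k"
      "\<forall>Q \<in> simple_paths G r w - C. \<forall>P \<in> C. path_weight \<omega> P \<le> path_weight \<omega> Q"
    using ex_smallest_subset_avoiding[OF finite_simple_paths[OF assms(1)]] by metis
  \<comment> \<open>This selects the branch of \<open>top_k_collections\<close> that asks for
    exactly \<open>k\<close> paths.\<close>
  have "k \<le> card (simple_paths G r w)"
    using C(1,2) finite_simple_paths[OF assms(1)] by (metis card_mono subset_trans Diff_subset)
  then have "C \<in> top_k_collections G \<omega> k r w"
    using C by (auto simp: top_k_collections_def)
  then show False
    using assms(11) C(1) by blast
qed

end
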